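(* Let $t\ge 3$ be an integer and $E_t=\{1,\ldots,t\}$. Consider the family $\mathcal{F}$ of all ordered pairs $(A,B)$ of subsets of $E_t$ such that $$|A|=j',\quad |B|=j'',\quad 0<|A\cap B|,\quad \max\{j',j''\}<|A\cup B|=t,\quad \mathfrak{q}(A\cap B)=\ell^{\cap},\quad \mathfrak{q}(A\triangle B)=\ell^{\triangle},$$ where $\ell^{\cap},\ell^{\triangle}\in\{1,\ldots,t\}$ are odd (thus $|A\cap B|=j'+j''-t>0$ and $|A\triangle B|=2t-(j'+j'')>0$). These are ordered two-member intersecting Sperner families that cover $E_t$. Ordered pairs of sets $(A,B)$ in the family $\mathcal{F}$ can be counted with the help of products that include subproducts of the form $$\mathtt{c}\bigl(\varrho(A\cap B);(j'+j'')-t\bigr)\cdot\mathtt{c}\bigl(\varrho(A\triangle B);2t-(j'+j'')\bigr):$$ (i) In the family $\mathcal{F}$ there are $$\mathtt{c}\bigl(\tfrac{\ell^{\cap}+1}{2};(j'+j'')-t\bigr)\cdot\mathtt{c}\bigl(\tfrac{\ell^{\triangle}+1}{2};2t-(j'+j'')\bigr)\cdot\binom{2t-(j'+j'')-1}{t-j''}$$ pairs $(A,B)$ such that $\{1,t\}\cap A=\{1\}$ and $\{1,t\}\cap B=\{1,t\}$, and if the subfamily of these pairs is nonempty, then $\ell^{\cap}=\ell^{\triangle}$. (ii) In the family $\mathcal{F}$ there are $$\mathtt{c}\bigl(\tfrac{\ell^{\cap}-1}{2};(j'+j'')-t\bigr)\cdot\mathtt{c}\bigl(\tfrac{\ell^{\triangle}+1}{2};2t-(j'+j'')\bigr)\cdot\binom{2t-(j'+j'')-2}{t-j''-1}$$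 pairs $(A,B)$ such that $\{1,t\}\cap A=\{1\}$ and $\{1,t\}\cap B=\{t\}$, and if the subfamily of these pairs is nonempty, then $\ell^{\cap}=\ell^{\triangle}$. (iii) In the family $\mathcal{F}$ there are $$\mathtt{c}\bigl(\tfrac{\ell^{\cap}+1}{2};(j'+j'')-t\bigr)\cdot\mathtt{c}\bigl(\tfrac{\ell^{\triangle}-1}{2};2t-(j'+j'')\bigr)\cdot\binom{2t-(j'+j'')}{t-j''}$$ pairs $(A,B)$ such that $\{1,t\}\cap A=\{1,t\}\cap B=\{1,t\}$, and if the subfamily of these pairs is nonempty, then $\ell^{\cap}=\ell^{\triangle}$. (iv) In the family $\mathcal{F}$ there are $$\mathtt{c}\bigl(\tfrac{\ell^{\cap}-1}{2};(j'+j'')-t\bigr)\cdot\mathtt{c}\bigl(\tfrac{\ell^{\triangle}+1}{2};2t-(j'+j'')\bigr)\cdot\binom{2t-(j'+j'')-2}{t-j'}$$ pairs $(A,B)$ such that $\{1,t\}\cap A=\{1,t\}$ and $|\{1,t\}\cap B|=0$, and if the subfamily of these pairs is nonempty, then $\ell^{\cap}=\ell^{\triangle}$. (v) In the family $\mathcal{F}$ there are $$\mathtt{c}\bigl(\tfrac{\ell^{\cap}+1}{2};(j'+j'')-t\bigr)\cdot\mathtt{c}\bigl(\tfrac{\ell^{\triangle}+1}{2};2t-(j'+j'')\bigr)\cdot\binom{2t-(j'+j'')-1}{t-j'}$$ pairs $(A,B)$ such that $\{1,t\}\cap A=\{1,t\}$ and $\{1,t\}\cap B=\{t\}$, and if the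 subfamily of these pairs is nonempty, then $\ell^{\cap}=\ell^{\triangle}$.
   Context: The distinguished symmetric cycle $\boldsymbol{R}$ of the hypercube graph on $\{1,-1\}^t$ (vertices adjacent iff they differ in exactly one coordinate) has vertices $R^0,\ldots,R^{2t-1}$, where $R^0=(1,\ldots,1)$; for $1\le s\le t-1$, $R^s\in\{1,-1\}^t$ has entries $-1$ exactly in positions $1,\ldots,s$; and $R^{k+t}=-R^k$ for $0\le k\le t-1$. The vectors $R^0,\ldots,R^{t-1}$ form a basis of $\mathbb{R}^t$, and for every $T\in\{1,-1\}^t$ there is a unique $\boldsymbol{x}=(x_1,\ldots,x_t)\in\{-1,0,1\}^t$ with $T=\sum_{i=1}^t x_iR^{i-1}$. Put $\boldsymbol{Q}(T,\boldsymbol{R})=\{x_iR^{i-1}\colon x_i\ne 0\}$; it is the unique inclusion-minimal subset of $\{R^0,\ldots,R^{2t-1}\}$ with sum $T$, and it has odd cardinality. For $A\subseteq E_t$, ${}_{-A}\mathrm{T}^{(+)}$ is the vector in $\{1,-1\}^t$ whose set of coordinates equal to $-1$ is $A$, and $\mathfrak{q}(A)=|\boldsymbol{Q}({}_{-A}\mathrm{T}^{(+)},\boldsymbol{R})|$. For a nonempty set $A\subseteq E_t$, $\varrho(A)$ is the number of intervals in the decomposition $A=[i_1,j_1]\,\dot\cup\,\cdots\,\dot\cup\,[i_{\varrho(A)},j_{\varrho(A)}]$ into disjoint intervals of $E_t$ with $j_k+2\le i_{k+1}$ for all $1\le k<\varrho(A)$. $\mathtt{c}(m;n)=\binom{n-1}{m-1}$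 is the number of compositions of a positive integer $n$ with $m$ positive parts. $A\triangle B$ denotes the symmetric difference. For pairs $(A,B)$ in the family, the Hamming distance between ${}_{-A}\mathrm{T}^{(+)}$ and ${}_{-B}\mathrm{T}^{(+)}$ is $2t-j'-j''$, and their standard scalar product is zero iff $2(j'+j'')=3t$.
   Formalization: The products count the pairs only when ℓ^∩ = ℓ^△; otherwise each subfamily is shown to be empty, though the product may be nonzero (t=3, j'=j''=2, ℓ^∩=1, ℓ^△=3 in (i)). The conditions max{j',j''}<t<j'+j'' are taken as assumptions on the parameters, and c(0;n)=0. *)

theory Defs
  imports Complex_Main
begin

text \<open>
  A vector of \<open>\<real>\<^sup>t\<close>, with coordinates indexed by \<open>E\<^sub>t = {1..t}\<close>, is represented by a function
  \<open>nat \<Rightarrow> real\<close> that vanishes outside \<open>{1..t}\<close>.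
\<close>

definition neg_part_vec :: "nat \<Rightarrow> nat set \<Rightarrow> nat \<Rightarrow> real" where
  "neg_part_vec t A = (\<lambda>e. if e \<in> {1..t} then (if e \<in> A then - 1 else 1) else 0)"

text \<open>
  The vertices \<open>R\<^sup>k\<close>, \<open>0 \<le> k \<le> 2t - 1\<close>, of the distinguished symmetric cycle. For \<open>k = 0\<close> the set
  \<open>{1..k}\<close> is empty, which gives the all-ones vector.
\<close>

definition cycle_vertex :: "nat \<Rightarrow> nat \<Rightarrow> nat \<Rightarrow> real" where
  "cycle_vertex t k =
     (if k < t then neg_part_vec t {1..k} else (\<lambda>e. - neg_part_vec t {1..k - t} e))"

text \<open>
  The coefficient vector \<open>x\<close> is unique because \<open>R\<^sup>0, \<dots>, R\<^sup>t\<^sup>-\<^sup>1\<close> is a basis; it exists with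
  entries in \<open>{-1, 0, 1}\<close> for every \<open>T \<in> {1,-1}\<^sup>t\<close>, the only vectors to which this is applied.
\<close>

definition cycle_coords :: "nat \<Rightarrow> (nat \<Rightarrow> real) \<Rightarrow> nat \<Rightarrow> real" where
  "cycle_coords t T =
     (THE x. (\<forall>i\<in>{1..t}. x i \<in> {- 1, 0, 1}) \<and> (\<forall>i. i \<notin> {1..t} \<longrightarrow> x i = 0) \<and>
             T = (\<lambda>e. \<Sum>i=1..t. x i * cycle_vertex t (i - 1) e))"

definition cycle_decomposition :: "nat \<Rightarrow> (nat \<Rightarrow> real) \<Rightarrow> (nat \<Rightarrow> real) set" where
  "cycle_decomposition t T =
     {(\<lambda>e. cycle_coords t T i * cycle_vertex t (i - 1) e) | i. i \<in> {1..t} \<and> cycle_coords t T i \<noteq> 0}"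

definition decomposition_size :: "nat \<Rightarrow> nat set \<Rightarrow> nat" where
  "decomposition_size t A = card (cycle_decomposition t (neg_part_vec t A))"

definition num_intervals :: "nat set \<Rightarrow> nat" where
  "num_intervals A =
     (THE r. \<exists>i j :: nat \<Rightarrow> nat. A = (\<Union>k\<in>{1..r}. {i k..j k}) \<and> (\<forall>k\<in>{1..r}. i k \<le> j k) \<and>
               (\<forall>k. 1 \<le> k \<and> k < r \<longrightarrow> j k + 2 \<le> i (k + 1)))"

text \<open>
  Number of compositions of \<open>n > 0\<close> with \<open>m\<close> parts. The case \<open>m = 0\<close> is the usual convention
  \<open>binom (n - 1) (-1) = 0\<close>; truncated subtraction would give \<open>1\<close> instead.
\<close>

definition num_compositions :: "nat \<Rightarrow> nat \<Rightarrow> nat" where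
  "num_compositions m n = (if m = 0 then 0 else (n - 1) choose (m - 1))"

definition pair_family :: "nat \<Rightarrow> nat \<Rightarrow> nat \<Rightarrow> nat \<Rightarrow> nat \<Rightarrow> (nat set \<times> nat set) set" where
  "pair_family t j1 j2 l_int l_sym =
     {(A, B). A \<subseteq> {1..t} \<and> B \<subseteq> {1..t} \<and> card A = j1 \<and> card B = j2 \<and>
        0 < card (A \<inter> B) \<and> max j1 j2 < card (A \<union> B) \<and> card (A \<union> B) = t \<and>
        decomposition_size t (A \<inter> B) = l_int \<and> decomposition_size t (sym_diff A B) = l_sym}"

text \<open>
  \<open>S\<close> is a subfamily, \<open>m\<close> and \<open>m'\<close> are the first arguments of the two composition numbers and
  \<open>b\<close> is the remaining binomial factor. A member of the family always satisfies
  \<open>l_int = l_sym\<close>, while the product below need not vanish when \<open>l_int \<noteq> l_sym\<close>. The product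
  is therefore asserted as the count for \<open>l_int = l_sym\<close>, and \<open>S\<close> is asserted to be empty
  otherwise.
\<close>

definition counted_by ::
  "nat \<Rightarrow> nat \<Rightarrow> nat \<Rightarrow> nat \<Rightarrow> nat \<Rightarrow> (nat set \<times> nat set) set \<Rightarrow> nat \<Rightarrow> nat \<Rightarrow> nat \<Rightarrow> bool" where
  "counted_by t j1 j2 l_int l_sym S m m' b \<longleftrightarrow>
     (l_int = l_sym \<longrightarrow>
        card S = num_compositions m (j1 + j2 - t) * num_compositions m' (2 * t - (j1 + j2)) * b) \<and>
     (S \<noteq> {} \<longrightarrow> l_int = l_sym) \<and>
     (\<forall>(A, B)\<in>S. num_intervals (A \<inter> B) = m \<and> num_intervals (sym_diff A B) = m')"

end

theory Submission
  imports Defs "HOL-Library.FuncSet"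
begin

text \<open>
  A pair \<open>(A, B)\<close> covering \<open>E\<^sub>t = {1..t}\<close> is the same as a set \<open>C = A \<inter> B\<close> together with a subset
  \<open>X = A - B\<close> of its complement: \<open>A = C \<union> X\<close> and \<open>B = E\<^sub>t - X\<close>, and the symmetric difference is
  \<open>E\<^sub>t - C\<close>. Prescribing \<open>A \<inter> {1, t}\<close> and \<open>B \<inter> {1, t}\<close> prescribes which of \<open>1\<close> and \<open>t\<close> lie in
  \<open>C\<close> and which of the others lie in \<open>X\<close>. For fixed \<open>C\<close> the number of \<open>X\<close> is the binomial factor of
  the formula (\<open>card_subsets_between\<close>), so what remains is to count the sets \<open>C\<close>.

  The coefficient of \<open>R\<^sup>i\<^sup>-\<^sup>1\<close>, \<open>i \<ge> 2\<close>, in the expansion of the vector of \<open>C\<close> is half the jump of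
  that vector from coordinate \<open>i - 1\<close> to \<open>i\<close>, and the coefficient of \<open>R\<^sup>0\<close> is half the sum of its
  first and last coordinates. Hence the number of nonzero coefficients is the number of places where
  membership in \<open>C\<close> changes, plus one if \<open>1\<close> and \<open>t\<close> are on the same side. Going through \<open>{1..t}\<close>, one
  meets the maximal intervals of \<open>C\<close> and of its complement alternately, so the decomposition size
  and the membership of \<open>1\<close> and \<open>t\<close> determine the numbers \<open>m\<close> and \<open>m'\<close> of these intervals, and
  conversely (\<open>decomposition_size_iff_runs\<close>). This description is symmetric under
  complementation, which is why \<open>l_int = l_sym\<close> for every pair in the family.

  A set with \<open>m\<close> intervals whose complement has \<open>m'\<close> is given by the lengths of the intervals:
  one composition of \<open>card C\<close> into \<open>m\<close> parts and one of \<open>t - card C\<close> into \<open>m'\<close> parts. This count is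
  \<open>card_subsets_by_runs\<close>. The first three boundary cases are instances of the resulting
  general statement \<open>counted_by_boundary\<close>; the last two follow by exchanging \<open>A\<close> and \<open>B\<close>.
\<close>

section \<open>Maximal intervals\<close>

text \<open>
  Counts the left ends of the maximal intervals. With truncated subtraction the element \<open>0\<close> is never
  a left end, so this is the number of intervals only for sets of positive numbers.
\<close>
definition runs :: "nat set \<Rightarrow> nat" where
  "runs A = card {e \<in> A. e - 1 \<notin> A}"

lemma separated_intervals_apart:
  fixes i j :: "nat \<Rightarrow> nat"
  assumes le: "\<forall>k\<in>{1..r}. i k \<le> j k"
    and sep: "\<forall>k. 1 \<le> k \<and> k < r \<longrightarrow> j k + 2 \<le> i (k + 1)"
    and k: "1 \<le> k"
  shows "k < k' \<Longrightarrow> k' \<le> r \<Longrightarrow> j k + 2 \<le> i k'"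
proof (induction k')
  case (Suc k')
  show ?case
  proof (cases "k = k'")
    case True
    then show ?thesis using sep k Suc.prems by auto
  next
    case False
    then have "j k + 2 \<le> i k'" using Suc by auto
    also have "i k' \<le> j k'" using le k False Suc.prems by auto
    also have "j k' \<le> i (Suc k')"
      using spec[OF sep, of k'] k Suc.prems by simp
    finally show ?thesis .
  qed
qed simp

text \<open>
  In any decomposition into separated intervals, the left ends of the intervals are exactly the
  elements of \<open>A\<close> without predecessor in \<open>A\<close>, because the gap of at least one point in front of
  each interval is outside \<open>A\<close>. So the number of intervals does not depend on the decomposition.
\<close>
lemma runs_separated_intervals:
  fixes i j :: "nat \<Rightarrow> nat"
  assumes "0 \<notin> A" and A: "A = (\<Union>k\<in>{1..r}. {i k..j k})"
    and le: "\<forall>k\<in>{1..r}. i k \<le> j k"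
    and sep: "\<forall>k. 1 \<le> k \<and> k < r \<longrightarrow> j k + 2 \<le> i (k + 1)"
  shows "runs A = r"
proof -
  note apart = separated_intervals_apart[OF le sep]
  have inA: "i k \<in> A" if "k \<in> {1..r}" for k
    using le that unfolding A by force
  have start: "i k - 1 \<notin> A" if k: "k \<in> {1..r}" for k
  proof
    assume "i k - 1 \<in> A"
    then obtain k' where k': "k' \<in> {1..r}" "i k' \<le> i k - 1" "i k - 1 \<le> j k'"
      unfolding A by auto
    have "i k > 0" using inA[OF k] \<open>0 \<notin> A\<close> by (metis gr0I)
    consider "k' < k" | "k' = k" | "k < k'" by linarith
    then show False
    proof cases
      case 1
      then show False using apart[of k' k] k k' by auto
    next
      case 2
      then show False using k' \<open>i k > 0\<close> by auto
    next
      case 3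
      then have "j k + 2 \<le> i k'" using apart k k' by auto
      then show False using k' le k by force
    qed
  qed
  have "{e \<in> A. e - 1 \<notin> A} = i ` {1..r}"
  proof (intro equalityI subsetI)
    fix e assume e: "e \<in> {e \<in> A. e - 1 \<notin> A}"
    then obtain k where k: "k \<in> {1..r}" "i k \<le> e" "e \<le> j k" unfolding A by auto
    have "e = i k"
    proof (rule ccontr)
      assume "e \<noteq> i k"
      then have "e - 1 \<in> {i k..j k}" using k by auto
      then show False using e k(1) unfolding A by blast
    qed
    then show "e \<in> i ` {1..r}" using k by auto
  qed (use inA start in auto)
  moreover have "inj_on i {1..r}"
  proof (rule linorder_inj_onI)
    fix x y assume "x < y" "x \<in> {1..r}" "y \<in> {1..r}"
    then have "j x + 2 \<le> i y" "i x \<le> j x" using apart le by auto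
    then show "i x \<noteq> i y" by linarith
  qed auto
  ultimately show ?thesis by (simp add: runs_def card_image)
qed

text \<open>
  The set is built up by adding a new maximum \<open>b\<close>, which either lengthens the last interval, if
  \<open>b - 1\<close> is present, or forms an interval of its own.
\<close>
lemma separated_intervals_exist:
  fixes A :: "nat set"
  assumes "finite A"
  shows "\<exists>r. \<exists>i j :: nat \<Rightarrow> nat. A = (\<Union>k\<in>{1..r}. {i k..j k}) \<and> (\<forall>k\<in>{1..r}. i k \<le> j k) \<and>
           (\<forall>k. 1 \<le> k \<and> k < r \<longrightarrow> j k + 2 \<le> i (k + 1))"
  using assms
proof (induction rule: finite_linorder_max_induct)
  case empty
  show ?case by (intro exI[of _ 0]) auto
next
  case (insert b A)
  then obtain r and i j :: "nat \<Rightarrow> nat" where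
    A: "A = (\<Union>k\<in>{1..r}. {i k..j k})" and
    le: "\<forall>k\<in>{1..r}. i k \<le> j k" and
    sep: "\<forall>k. 1 \<le> k \<and> k < r \<longrightarrow> j k + 2 \<le> i (k + 1)"
    by blast
  have iA: "i k \<in> A" and jA: "j k \<in> A" if "k \<in> {1..r}" for k
    using le that unfolding A by force+
  show ?case
  proof (cases "b \<noteq> 0 \<and> b - 1 \<in> A")
    case True
    then obtain k where k: "k \<in> {1..r}" "i k \<le> b - 1" "b - 1 \<le> j k" unfolding A by auto
    have jk: "j k = b - 1" using jA[OF k(1)] insert.hyps k by fastforce
    \<comment> \<open>The interval ending in \<open>b - 1\<close> is the last one, as any later one would lie beyond \<open>b\<close>.\<close>
    have kr: "k = r"
    proof (rule ccontr)
      assume "k \<noteq> r"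
      then have "j k + 2 \<le> i (k + 1)" "i (k + 1) \<in> A" using sep k iA by auto
      then show False using jk insert.hyps by fastforce
    qed
    have last: "{i r..b} = insert b {i r..j r}" using k jk kr True by auto
    have split: "{1..r} = insert r {1..<r}" using k by auto
    have "insert b A = (\<Union>k\<in>{1..r}. {i k..(j(r := b)) k})"
      unfolding A split using last by auto
    moreover have "\<forall>k\<in>{1..r}. i k \<le> (j(r := b)) k" using le k kr by auto
    moreover have "\<forall>k. 1 \<le> k \<and> k < r \<longrightarrow> (j(r := b)) k + 2 \<le> i (k + 1)" using sep by auto
    ultimately show ?thesis by blast
  next
    case False
    have far: "e + 2 \<le> b" if "e \<in> A" for e
    proof -
      have "e < b" "e \<noteq> b - 1" using False insert.hyps that by auto
      then show ?thesis by linarith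
    qed
    have split: "{1..Suc r} = insert (Suc r) {1..r}" by auto
    have "insert b A = (\<Union>k\<in>{1..Suc r}. {(i(Suc r := b)) k..(j(Suc r := b)) k})"
      unfolding A split by auto
    moreover have "\<forall>k\<in>{1..Suc r}. (i(Suc r := b)) k \<le> (j(Suc r := b)) k" using le by auto
    moreover have "\<forall>k. 1 \<le> k \<and> k < Suc r \<longrightarrow>
        (j(Suc r := b)) k + 2 \<le> (i(Suc r := b)) (k + 1)"
    proof (intro allI impI)
      fix k assume k: "1 \<le> k \<and> k < Suc r"
      then show "(j(Suc r := b)) k + 2 \<le> (i(Suc r := b)) (k + 1)"
        using sep far[OF jA, of k] by (cases "k = r") auto
    qed
    ultimately show ?thesis by blast
  qed
qed

lemma num_intervals_eq_runs:
  assumes "finite A" "0 \<notin> A"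
  shows "num_intervals A = runs A"
  unfolding num_intervals_def
proof (rule the_equality)
  obtain r and i j :: "nat \<Rightarrow> nat" where rep: "A = (\<Union>k\<in>{1..r}. {i k..j k})"
    "\<forall>k\<in>{1..r}. i k \<le> j k" "\<forall>k. 1 \<le> k \<and> k < r \<longrightarrow> j k + 2 \<le> i (k + 1)"
    using separated_intervals_exist[OF assms(1)] by (elim exE conjE)
  have r: "runs A = r" by (rule runs_separated_intervals[OF assms(2) rep])
  show "\<exists>i j :: nat \<Rightarrow> nat. A = (\<Union>k\<in>{1..runs A}. {i k..j k}) \<and>
      (\<forall>k\<in>{1..runs A}. i k \<le> j k) \<and> (\<forall>k. 1 \<le> k \<and> k < runs A \<longrightarrow> j k + 2 \<le> i (k + 1))"
    unfolding r by (intro exI conjI) (fact rep)+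
next
  fix r
  assume "\<exists>i j :: nat \<Rightarrow> nat. A = (\<Union>k\<in>{1..r}. {i k..j k}) \<and>
      (\<forall>k\<in>{1..r}. i k \<le> j k) \<and> (\<forall>k. 1 \<le> k \<and> k < r \<longrightarrow> j k + 2 \<le> i (k + 1))"
  then show "r = runs A"
    by (elim exE conjE) (rule runs_separated_intervals[OF assms(2), symmetric])
qed

lemma runs_pos:
  assumes "finite A" "A \<noteq> {}" "0 \<notin> A"
  shows "0 < runs A"
proof -
  have min: "Min A \<in> A" "Min A \<noteq> 0" using assms Min_in by metis+
  then have "Min A - 1 \<notin> A" using Min_le[OF assms(1), of "Min A - 1"] by auto
  then show ?thesis using min assms(1) by (auto simp: runs_def card_gt_0_iff)
qed

lemma runs_empty: "runs {} = 0"
  by (simp add: runs_def)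

lemma runs_singleton: "runs {Suc 0} = 1"
proof -
  have "{e \<in> {Suc 0}. e - 1 \<notin> {Suc 0}} = {Suc 0}" by auto
  then show ?thesis by (simp add: runs_def)
qed

lemma runs_insert_Suc:
  assumes "C \<subseteq> {1..t}"
  shows "runs (insert (Suc t) C) = runs C + (if t \<in> C then 0 else 1)"
proof -
  have fin: "finite C" using assms finite_subset by blast
  have "e - 1 \<noteq> Suc t" if "e \<in> C" for e using assms that by fastforce
  then have "{e \<in> insert (Suc t) C. e - 1 \<notin> insert (Suc t) C} =
      (if t \<in> C then {} else {Suc t}) \<union> {e \<in> C. e - 1 \<notin> C}"
    by auto
  moreover have "Suc t \<notin> C" using assms by auto
  ultimately show ?thesis using fin by (simp add: runs_def)
qed

text \<open>
  The intervals of a set and of its complement alternate, so their numbers differ by at most one,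
  and the sign of the difference depends only on the sides on which \<open>1\<close> and \<open>t\<close> lie.
\<close>
lemma runs_complement:
  assumes "1 \<le> t" "C \<subseteq> {1..t}"
  shows "runs C + of_bool (t \<notin> C) = runs ({1..t} - C) + of_bool (1 \<in> C)"
  using assms
proof (induction t arbitrary: C rule: dec_induct)
  case base
  then have "C = {} \<or> C = {1}" by auto
  then show ?case using runs_empty runs_singleton by auto
next
  case (step t)
  define C' where "C' = C \<inter> {1..t}"
  define D' where "D' = {1..t} - C"
  have IH: "runs C' + of_bool (t \<notin> C') = runs ({1..t} - C') + of_bool (1 \<in> C')"
    by (rule step.IH) (auto simp: C'_def)
  have D': "{1..t} - C' = D'" "D' \<subseteq> {1..t}" "C' \<subseteq> {1..t}" by (auto simp: C'_def D'_def)
  have one: "1 \<in> C' \<longleftrightarrow> 1 \<in> C" and top: "t \<in> D' \<longleftrightarrow> t \<notin> C'"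
    using step.hyps by (auto simp: C'_def D'_def)
  show ?case
  proof (cases "Suc t \<in> C")
    case True
    then have "C = insert (Suc t) C'" "{1..Suc t} - C = D'"
      using step.prems by (auto simp: C'_def D'_def le_Suc_eq)
    moreover have "runs (insert (Suc t) C') = runs C' + of_bool (t \<notin> C')"
      using runs_insert_Suc[OF D'(3)] by simp
    ultimately show ?thesis using IH D'(1) one True by simp
  next
    case False
    then have "C' = C" "{1..Suc t} - C = insert (Suc t) D'"
      using step.prems by (auto simp: C'_def D'_def le_Suc_eq)
    moreover have "runs (insert (Suc t) D') = runs D' + of_bool (t \<in> C')"
      using runs_insert_Suc[OF D'(2)] top by simp
    ultimately show ?thesis using IH D'(1) False by (simp add: of_bool_def split: if_splits)
  qed
qed

text \<open>
  Each place where membership changes starts an interval of one of the two sides, and the only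
  other interval start is \<open>1\<close>.
\<close>
lemma runs_add_complement:
  assumes "1 \<le> t" "C \<subseteq> {1..t}"
  shows "runs C + runs ({1..t} - C) = card {e \<in> {2..t}. (e \<in> C) \<noteq> (e - 1 \<in> C)} + 1"
proof -
  let ?S = "{e \<in> C. e - 1 \<notin> C}" and ?D = "{1..t} - C"
  let ?S' = "{e \<in> ?D. e - 1 \<notin> ?D}" and ?X = "{e \<in> {2..t}. (e \<in> C) \<noteq> (e - 1 \<in> C)}"
  have "?S \<union> ?S' = insert 1 ?X"
  proof (intro equalityI subsetI)
    fix e assume "e \<in> ?S \<union> ?S'"
    then show "e \<in> insert 1 ?X" using assms by (cases "e = 1") auto
  next
    fix e assume "e \<in> insert 1 ?X"
    then show "e \<in> ?S \<union> ?S'" using assms by (cases "e = 1") auto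
  qed
  moreover have "card (?S \<union> ?S') = card ?S + card ?S'"
    using finite_subset[OF assms(2)] by (intro card_Un_disjoint) auto
  ultimately show ?thesis by (simp add: runs_def)
qed

section \<open>The decomposition with respect to the cycle\<close>
lemma cycle_vertex_low:
  assumes "k < t" "e \<in> {1..t}"
  shows "cycle_vertex t k e = (if e \<le> k then -1 else 1)"
  using assms by (simp add: cycle_vertex_def neg_part_vec_def)

text \<open>
  Among \<open>R\<^sup>0, \<dots>, R\<^sup>t\<^sup>-\<^sup>1\<close> only \<open>R\<^sup>e\<^sup>-\<^sup>1\<close> changes sign between coordinates \<open>e - 1\<close> and \<open>e\<close>, so
  this difference isolates one coefficient.
\<close>
lemma cycle_combination_diff:
  assumes "e \<in> {2..t}"
  shows "(\<Sum>i=1..t. x i * cycle_vertex t (i - 1) e) -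
    (\<Sum>i=1..t. x i * cycle_vertex t (i - 1) (e - 1)) = 2 * x e"
proof -
  have "(\<Sum>i=1..t. x i * cycle_vertex t (i - 1) e) -
      (\<Sum>i=1..t. x i * cycle_vertex t (i - 1) (e - 1)) = (\<Sum>i=1..t. if i = e then 2 * x i else 0)"
    unfolding sum_subtractf[symmetric]
  proof (rule sum.cong[OF refl])
    fix i assume i: "i \<in> {1..t}"
    have e: "e \<in> {1..t}" "e - 1 \<in> {1..t}" "i - 1 < t" using assms i by auto
    show "x i * cycle_vertex t (i - 1) e - x i * cycle_vertex t (i - 1) (e - 1) =
        (if i = e then 2 * x i else 0)"
      unfolding cycle_vertex_low[OF e(3) e(1)] cycle_vertex_low[OF e(3) e(2)]
      using i assms by auto
  qed
  then show ?thesis using assms by simp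
qed

text \<open>
  All of \<open>R\<^sup>1, \<dots>, R\<^sup>t\<^sup>-\<^sup>1\<close> have opposite signs in coordinates \<open>1\<close> and \<open>t\<close>, so the sum of the two
  isolates the coefficient of \<open>R\<^sup>0\<close>.
\<close>
lemma cycle_combination_ends:
  assumes "1 \<le> t"
  shows "(\<Sum>i=1..t. x i * cycle_vertex t (i - 1) 1) +
    (\<Sum>i=1..t. x i * cycle_vertex t (i - 1) t) = 2 * x 1"
proof -
  have "(\<Sum>i=1..t. x i * cycle_vertex t (i - 1) 1) +
      (\<Sum>i=1..t. x i * cycle_vertex t (i - 1) t) = (\<Sum>i=1..t. if i = 1 then 2 * x i else 0)"
    unfolding sum.distrib[symmetric]
    using assms by (intro sum.cong) (auto simp: cycle_vertex_low)
  then show ?thesis using assms by simp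
qed

text \<open>
  Uniqueness is immediate from the two identities above. For existence they show that the
  combination with these coefficients has the same jumps as \<open>T\<close>, hence differs from \<open>T\<close> by a
  constant on \<open>{1..t}\<close>, and the constant is zero because the sums of the end coordinates agree.
\<close>
lemma cycle_coords_neg_part_vec:
  fixes C :: "nat set"
  assumes "1 \<le> t"
  defines "T \<equiv> neg_part_vec t C"
  shows "cycle_coords t T =
    (\<lambda>i. if i = 1 then (T 1 + T t) / 2 else if i \<in> {2..t} then (T i - T (i - 1)) / 2 else 0)"
  (is "_ = ?y")
  unfolding cycle_coords_def
proof (rule the_equality)
  let ?S = "\<lambda>x e. \<Sum>i=1..t. x i * cycle_vertex t (i - 1) e"
  have zero: "T e = 0" if "e \<notin> {1..t}" for e using that by (auto simp: T_def neg_part_vec_def)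
  have outside: "?S x e = 0" if "e \<notin> {1..t}" for x :: "nat \<Rightarrow> real" and e
    using that by (intro sum.neutral) (auto simp: cycle_vertex_def neg_part_vec_def)
  have shift: "?S ?y e - T e = ?S ?y 1 - T 1" if "e \<in> {1..t}" for e
    using that
  proof (induction e)
    case (Suc e)
    show ?case
    proof (cases "e = 0")
      case False
      then show ?thesis using Suc cycle_combination_diff[of "Suc e" t ?y] by auto
    qed simp
  qed simp
  have "?S ?y 1 - T 1 = 0"
    using shift[of t] cycle_combination_ends[of t ?y] assms by auto
  then have "?S ?y e = T e" for e using shift[of e] zero outside by (cases "e \<in> {1..t}") auto
  moreover have "?y i \<in> {-1, 0, 1}" for i using assms by (auto simp: T_def neg_part_vec_def)
  ultimately show "(\<forall>i\<in>{1..t}. ?y i \<in> {-1, 0, 1}) \<and> (\<forall>i. i \<notin> {1..t} \<longrightarrow> ?y i = 0) \<and> T = ?S ?y"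
    using assms by auto
next
  fix x assume x: "(\<forall>i\<in>{1..t}. x i \<in> {-1, 0, 1}) \<and> (\<forall>i. i \<notin> {1..t} \<longrightarrow> x i = 0) \<and>
    T = (\<lambda>e. \<Sum>i=1..t. x i * cycle_vertex t (i - 1) e)"
  show "x = ?y"
  proof
    fix i
    consider "i = 1" | "i \<in> {2..t}" | "i \<notin> {1..t}" using assms by force
    then show "x i = ?y i"
    proof cases
      case 1
      have "T 1 + T t = 2 * x 1" using x cycle_combination_ends[OF assms(1), of x] by simp
      then show ?thesis using 1 by simp
    next
      case 2
      have "T i - T (i - 1) = 2 * x i" using x cycle_combination_diff[OF 2, of x] by simp
      then show ?thesis using 2 by auto
    next
      case 3
      then show ?thesis using x assms by auto
    qed
  qed
qed

text \<open>
  Both sides count one more than the nonzero coefficients: a coefficient with index \<open>i \<ge> 2\<close> is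
  nonzero iff membership changes at \<open>i\<close>, and the first one iff \<open>1\<close> and \<open>t\<close> lie on the same side.
\<close>
lemma decomposition_size_runs:
  assumes "1 \<le> t" "C \<subseteq> {1..t}"
  shows "decomposition_size t C + 1 =
    runs C + runs ({1..t} - C) + of_bool (1 \<in> C \<longleftrightarrow> t \<in> C)"
proof -
  define x where "x = cycle_coords t (neg_part_vec t C)"
  let ?I = "{i \<in> {1..t}. x i \<noteq> 0}" and ?X = "{e \<in> {2..t}. (e \<in> C) \<noteq> (e - 1 \<in> C)}"
  have x1: "x 1 \<noteq> 0 \<longleftrightarrow> (1 \<in> C \<longleftrightarrow> t \<in> C)"
    unfolding x_def cycle_coords_neg_part_vec[OF assms(1)]
    using assms by (auto simp: neg_part_vec_def)
  have xi: "x i \<noteq> 0 \<longleftrightarrow> (i \<in> C) \<noteq> (i - 1 \<in> C)" if "i \<in> {2..t}" for i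
    unfolding x_def cycle_coords_neg_part_vec[OF assms(1)]
    using assms that by (auto simp: neg_part_vec_def)
  \<comment> \<open>The size of the decomposition is that of a set of vectors, so distinct indices have to give
    distinct vectors: coordinate \<open>t\<close> forces equal coefficients, coordinate \<open>i\<close> opposite ones.\<close>
  have "inj_on (\<lambda>i e. x i * cycle_vertex t (i - 1) e) ?I"
  proof (rule linorder_inj_onI)
    fix i k assume ik: "i < k" "i \<in> ?I" "k \<in> ?I"
    show "(\<lambda>e. x i * cycle_vertex t (i - 1) e) \<noteq> (\<lambda>e. x k * cycle_vertex t (k - 1) e)"
    proof
      assume eq: "(\<lambda>e. x i * cycle_vertex t (i - 1) e) = (\<lambda>e. x k * cycle_vertex t (k - 1) e)"
      have "i - 1 < t" "k - 1 < t" "t \<in> {1..t}" using ik by auto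
      then have "x i = x k" using fun_cong[OF eq, of t] by (simp add: cycle_vertex_low not_le[symmetric])
      moreover have "x i = - x k" using fun_cong[OF eq, of i] ik by (auto simp: cycle_vertex_low split: if_splits)
      ultimately show False using ik by auto
    qed
  qed auto
  then have "decomposition_size t C = card ?I"
    unfolding decomposition_size_def cycle_decomposition_def x_def[symmetric]
    by (subst card_image[symmetric]) (auto intro!: arg_cong[where f = card])
  also have "?I = (if 1 \<in> C \<longleftrightarrow> t \<in> C then {1} else {}) \<union> ?X"
  proof (intro set_eqI)
    fix i
    show "i \<in> ?I \<longleftrightarrow> i \<in> (if 1 \<in> C \<longleftrightarrow> t \<in> C then {1} else {}) \<union> ?X"
      using x1 xi[of i] assms(1) by (cases "i = 1") auto
  qed
  also have "card \<dots> = of_bool (1 \<in> C \<longleftrightarrow> t \<in> C) + card ?X" by simp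
  finally show ?thesis using runs_add_complement[OF assms] by simp
qed

section \<open>Counting sets by their intervals\<close>

text \<open>
  Compositions of \<open>n\<close> into \<open>m\<close> positive parts, where \<open>0\<close> has the empty composition. A composition
  of \<open>Suc n\<close> arises by lengthening the last part or by appending a part \<open>1\<close>. Including
  \<open>n = 0\<close> keeps the product formula below valid for the empty set and the full set, through which
  the induction passes.
\<close>
fun compositions :: "nat \<Rightarrow> nat \<Rightarrow> nat" where
  "compositions 0 0 = 1"
| "compositions 0 (Suc n) = 0"
| "compositions (Suc m) 0 = 0"
| "compositions (Suc m) (Suc n) = compositions (Suc m) n + compositions m n"

lemma compositions_eq_num_compositions:
  "0 < n \<Longrightarrow> compositions m n = num_compositions m n"
proof (induction m n rule: compositions.induct)
  case (4 m n)
  show ?case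
  proof (cases n)
    case 0
    then show ?thesis by (cases m) (auto simp: num_compositions_def)
  next
    case (Suc k)
    then show ?thesis using 4 by (cases m) (auto simp: num_compositions_def)
  qed
qed (auto simp: num_compositions_def)

lemma card_subsets_by_runs_complement:
  assumes "p \<le> t" "1 \<le> t"
  shows "card {C. C \<subseteq> {1..t} \<and> card C = p \<and> runs C = m \<and> runs ({1..t} - C) = m' \<and> t \<notin> C} =
    card {C. C \<subseteq> {1..t} \<and> card C = t - p \<and> runs C = m' \<and> runs ({1..t} - C) = m \<and> t \<in> C}"
proof (rule bij_betw_same_card, rule bij_betwI[where g = "\<lambda>C. {1..t} - C"])
  have dbl: "{1..t} - ({1..t} - C) = C" if "C \<subseteq> {1..t}" for C using that by auto
  have card: "card ({1..t} - C) = t - card C" if "C \<subseteq> {1..t}" for C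
    using that by (simp add: card_Diff_subset finite_subset)
  show "(\<lambda>C. {1..t} - C) \<in>
      {C. C \<subseteq> {1..t} \<and> card C = p \<and> runs C = m \<and> runs ({1..t} - C) = m' \<and> t \<notin> C} \<rightarrow>
      {C. C \<subseteq> {1..t} \<and> card C = t - p \<and> runs C = m' \<and> runs ({1..t} - C) = m \<and> t \<in> C}"
    by (rule funcsetI) (use assms in \<open>auto simp: card dbl simp del: One_nat_def\<close>)
  show "(\<lambda>C. {1..t} - C) \<in>
      {C. C \<subseteq> {1..t} \<and> card C = t - p \<and> runs C = m' \<and> runs ({1..t} - C) = m \<and> t \<in> C} \<rightarrow>
      {C. C \<subseteq> {1..t} \<and> card C = p \<and> runs C = m \<and> runs ({1..t} - C) = m' \<and> t \<notin> C}"
    by (rule funcsetI) (use assms in \<open>auto simp: card dbl simp del: One_nat_def\<close>)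
qed (auto simp: double_diff)

text \<open>
  Induction on \<open>t\<close>. Removing \<open>Suc t\<close> from a set that contains it shortens the last interval if the
  set contains \<open>t\<close>, and otherwise deletes an interval and leaves a set whose complement
  contains \<open>t\<close>; the latter sets are counted, via complementation, by the same formula. The
  two counts add up by the recursion of \<open>compositions\<close>. Membership of \<open>t\<close> leaves two
  possibilities for \<open>m\<close>, according to the side of \<open>1\<close>.
\<close>
lemma card_subsets_by_runs:
  assumes "1 \<le> t" "p \<le> t"
  shows "card {C. C \<subseteq> {1..t} \<and> card C = p \<and> runs C = m \<and> runs ({1..t} - C) = m' \<and> t \<in> C} =
    (if m = m' \<or> m = Suc m' then compositions m p * compositions m' (t - p) else 0)"
  using assms
proof (induction t arbitrary: p m m' rule: dec_induct)
  case base
  have singleton: "{C. C \<subseteq> {1..1} \<and> card C = p \<and> runs C = m \<and> runs ({1..1} - C) = m' \<and> 1 \<in> C} =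
    (if p = 1 \<and> m = 1 \<and> m' = 0 then {{1::nat}} else {})"
  proof -
    have "C \<subseteq> {1..1} \<and> 1 \<in> C \<longleftrightarrow> C = {1}" for C :: "nat set" by auto
    then have "{C. C \<subseteq> {1..1} \<and> card C = p \<and> runs C = m \<and> runs ({1..1} - C) = m' \<and> 1 \<in> C} =
        {C. C = {1} \<and> card C = p \<and> runs C = m \<and> runs ({1..1} - C) = m'}" by blast
    also have "\<dots> = {C. C = {1} \<and> 1 = p \<and> 1 = m \<and> 0 = m'}"
      by (intro Collect_cong conj_cong refl) (auto simp: runs_singleton runs_empty)
    finally show ?thesis by auto
  qed
  have "p = 0 \<or> p = 1" using base by auto
  then show ?case
    unfolding singleton using base by (cases m; cases m') auto
next
  case (step t)
  let ?K = "\<lambda>t p m m'. {C. C \<subseteq> {1..t} \<and> card C = p \<and> runs C = m \<and> runs ({1..t} - C) = m' \<and> t \<in> C}"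
  let ?N = "\<lambda>t p m m'. {C. C \<subseteq> {1..t} \<and> card C = p \<and> runs C = m \<and> runs ({1..t} - C) = m' \<and> t \<notin> C}"
  show ?case
  proof (cases "p = 0 \<or> m = 0")
    case True
    have "?K (Suc t) p m m' = {}"
    proof -
      have False if "C \<in> ?K (Suc t) p m m'" for C
      proof -
        have "finite C" using that finite_subset by blast
        then have "0 < card C" "0 < runs C" using that by (force simp: card_gt_0_iff intro!: runs_pos)+
        then show False using that True by auto
      qed
      then show ?thesis by blast
    qed
    moreover have "m = m' \<or> m = Suc m' \<Longrightarrow> compositions m p * compositions m' (Suc t - p) = 0"
      using True step.prems by (cases p; cases m) auto
    ultimately show ?thesis by (auto simp del: mult_is_0)
  next
    case False
    then obtain q n where p: "p = Suc q" and m: "m = Suc n" by (metis not0_implies_Suc)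
    have q: "q \<le> t" using step.prems p by simp
    have top: "Suc t \<notin> C" "{1..Suc t} - insert (Suc t) C = {1..t} - C" if "C \<subseteq> {1..t}" for C
      using that by (auto simp: le_Suc_eq)
    have "?K (Suc t) p m m' = insert (Suc t) ` (?K t q m m' \<union> ?N t q n m')"
    proof (intro equalityI subsetI)
      fix C assume C: "C \<in> ?K (Suc t) p m m'"
      define C' where "C' = C - {Suc t}"
      have C': "C' \<subseteq> {1..t}" "C = insert (Suc t) C'" using C by (auto simp: C'_def le_Suc_eq)
      moreover have "finite C'" using C' finite_subset by blast
      ultimately have "C' \<in> ?K t q m m' \<union> ?N t q n m'"
        using C top[OF C'(1)] runs_insert_Suc[OF C'(1)] by (auto simp: p m split: if_splits)
      then show "C \<in> insert (Suc t) ` (?K t q m m' \<union> ?N t q n m')" using C' by blast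
    next
      fix C assume "C \<in> insert (Suc t) ` (?K t q m m' \<union> ?N t q n m')"
      then obtain C' where C': "C' \<in> ?K t q m m' \<union> ?N t q n m'" "C = insert (Suc t) C'" by blast
      then have sub: "C' \<subseteq> {1..t}" by auto
      then have "finite C'" using finite_subset by blast
      then show "C \<in> ?K (Suc t) p m m'"
        using C' sub top[OF sub] runs_insert_Suc[OF sub] by (fastforce simp: p m)
    qed
    moreover have "inj_on (insert (Suc t)) (?K t q m m' \<union> ?N t q n m')"
    proof (rule inj_onI)
      fix C D assume "C \<in> ?K t q m m' \<union> ?N t q n m'" "D \<in> ?K t q m m' \<union> ?N t q n m'"
      then have "Suc t \<notin> C" "Suc t \<notin> D" using top(1) by blast+
      then show "insert (Suc t) C = insert (Suc t) D \<Longrightarrow> C = D" by (metis insert_ident)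
    qed
    moreover have "finite (?K t q m m')" "finite (?N t q n m')"
      by (rule finite_subset[of _ "Pow {1..t}"]; blast)+
    then have "card (?K t q m m' \<union> ?N t q n m') = card (?K t q m m') + card (?N t q n m')"
      by (rule card_Un_disjoint) blast
    ultimately have "card (?K (Suc t) p m m') = card (?K t q m m') + card (?K t (t - q) m' n)"
      by (simp only: card_image card_subsets_by_runs_complement[OF q step.hyps(1)])
    also have "\<dots> = (if m = m' \<or> m = Suc m' then compositions m p * compositions m' (Suc t - p) else 0)"
      unfolding step.IH[OF q] step.IH[OF diff_le_self] using q
      by (auto simp: p m algebra_simps)
    finally show ?thesis .
  qed
qed

lemma card_subsets_between:
  assumes "finite G" "U \<subseteq> G" "card U \<le> k"
  shows "card {X. U \<subseteq> X \<and> X \<subseteq> G \<and> card X = k} = (card G - card U) choose (k - card U)"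
proof -
  have fU: "finite U" using assms finite_subset by blast
  have "bij_betw (\<lambda>X. X - U) {X. U \<subseteq> X \<and> X \<subseteq> G \<and> card X = k}
      {Y. Y \<subseteq> G - U \<and> card Y = k - card U}"
  proof (rule bij_betwI[where g = "\<lambda>Y. Y \<union> U"])
    show "(\<lambda>X. X - U) \<in> {X. U \<subseteq> X \<and> X \<subseteq> G \<and> card X = k} \<rightarrow>
        {Y. Y \<subseteq> G - U \<and> card Y = k - card U}"
      using fU by (auto simp: card_Diff_subset)
    show "(\<lambda>Y. Y \<union> U) \<in> {Y. Y \<subseteq> G - U \<and> card Y = k - card U} \<rightarrow>
        {X. U \<subseteq> X \<and> X \<subseteq> G \<and> card X = k}"
    proof (rule funcsetI)
      fix Y assume Y: "Y \<in> {Y. Y \<subseteq> G - U \<and> card Y = k - card U}"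
      then have "finite Y" using assms(1) finite_subset by blast
      then have "card (Y \<union> U) = k" using Y fU assms(3) by (subst card_Un_disjoint) auto
      then show "Y \<union> U \<in> {X. U \<subseteq> X \<and> X \<subseteq> G \<and> card X = k}" using Y assms(2) by auto
    qed
  qed auto
  then have "card {X. U \<subseteq> X \<and> X \<subseteq> G \<and> card X = k} = card (G - U) choose (k - card U)"
    using n_subsets[of "G - U" "k - card U"] assms(1) by (simp add: bij_betw_same_card)
  then show ?thesis using fU assms(2) by (simp add: card_Diff_subset)
qed

section \<open>Pairs and their intersections\<close>
lemma pair_family_member:
  assumes "(A, B) \<in> pair_family t j1 j2 l_int l_sym"
  shows "A \<union> B = {1..t}" "card (A \<inter> B) = j1 + j2 - t"
    "sym_diff A B = {1..t} - A \<inter> B" "card (sym_diff A B) = 2 * t - (j1 + j2)"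
    "card (A - B) = t - j2" "\<not> A \<subseteq> B" "\<not> B \<subseteq> A"
proof -
  have AB: "A \<subseteq> {1..t}" "B \<subseteq> {1..t}" "card A = j1" "card B = j2" "card (A \<union> B) = t"
    "max j1 j2 < card (A \<union> B)" "0 < card (A \<inter> B)"
    using assms by (auto simp: pair_family_def)
  have fin: "finite A" "finite B" using AB finite_subset by blast+
  show U: "A \<union> B = {1..t}" using AB by (intro card_subset_eq) auto
  have sum: "j1 + j2 = t + card (A \<inter> B)" using card_Un_Int[OF fin] AB by simp
  then show "card (A \<inter> B) = j1 + j2 - t" by simp
  show D: "sym_diff A B = {1..t} - A \<inter> B" unfolding U[symmetric] by blast
  have "card ({1..t} - A \<inter> B) = t - card (A \<inter> B)"
    using AB fin by (subst card_Diff_subset) auto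
  then show "card (sym_diff A B) = 2 * t - (j1 + j2)" unfolding D using sum by linarith
  have "card A = card (A - B) + card (A \<inter> B)"
    using card_Int_Diff[OF fin(1), of B] by simp
  then show "card (A - B) = t - j2" using sum AB by linarith
  show "\<not> A \<subseteq> B" using AB by (auto simp: Un_absorb1)
  show "\<not> B \<subseteq> A" using AB by (auto simp: Un_absorb2)
qed

lemma decomposition_size_complement:
  assumes "1 \<le> t" "C \<subseteq> {1..t}"
  shows "decomposition_size t ({1..t} - C) = decomposition_size t C"
proof -
  have "{1..t} - ({1..t} - C) = C" using assms by auto
  then show ?thesis
    using decomposition_size_runs[OF assms] decomposition_size_runs[of t "{1..t} - C"] assms by auto
qed

text \<open>
  The balance \<open>runs_complement\<close> and the sum \<open>decomposition_size_runs\<close> are two linear equations that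
  determine the two interval numbers from the decomposition size and the sides \<open>a\<close>, \<open>s\<close> of \<open>1\<close> and
  \<open>t\<close>. Conversely, the interval numbers and \<open>s\<close> give back \<open>a\<close> through the balance.
\<close>
lemma decomposition_size_iff_runs:
  assumes "1 \<le> t" "C \<subseteq> {1..t}" "odd l"
  shows "decomposition_size t C = l \<and> (1 \<in> C \<longleftrightarrow> a) \<and> (t \<in> C \<longleftrightarrow> s) \<longleftrightarrow>
    runs C = (l - 1) div 2 + of_bool (a \<or> s) \<and>
    runs ({1..t} - C) = (l - 1) div 2 + of_bool (\<not> a \<or> \<not> s) \<and> (t \<in> C \<longleftrightarrow> s)"
proof -
  obtain k where "l = 2 * k + 1" using assms(3) by (elim oddE)
  then show ?thesis
    using runs_complement[OF assms(1,2)] decomposition_size_runs[OF assms(1,2)]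
    by (cases a; cases s; cases "1 \<in> C"; cases "t \<in> C"; auto)
qed

lemma card_subsets_by_decomposition_size:
  assumes "1 \<le> t" "odd l" "0 < p" "p < t"
  shows "card {C. C \<subseteq> {1..t} \<and> card C = p \<and> decomposition_size t C = l \<and>
      (1 \<in> C \<longleftrightarrow> a) \<and> (t \<in> C \<longleftrightarrow> s)} =
    num_compositions ((l - 1) div 2 + of_bool (a \<or> s)) p *
    num_compositions ((l - 1) div 2 + of_bool (\<not> a \<or> \<not> s)) (t - p)"
    (is "card ?L = num_compositions ?m p * num_compositions ?m' (t - p)")
proof -
  have L: "?L = {C. C \<subseteq> {1..t} \<and> card C = p \<and> runs C = ?m \<and> runs ({1..t} - C) = ?m' \<and> (t \<in> C \<longleftrightarrow> s)}"
    using decomposition_size_iff_runs[OF assms(1) _ assms(2)] by blast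
  have "card ?L = compositions ?m p * compositions ?m' (t - p)"
  proof (cases s)
    case True
    then show ?thesis
      unfolding L using card_subsets_by_runs[of t p ?m ?m'] assms by (cases a) auto
  next
    case False
    then show ?thesis
      unfolding L using card_subsets_by_runs_complement[of p t ?m ?m'] assms(1,4)
        card_subsets_by_runs[OF assms(1), of "t - p" ?m' ?m] by (cases a) (simp_all add: mult.commute)
  qed
  then show ?thesis using assms by (simp add: compositions_eq_num_compositions)
qed

text \<open>
  The common form of the boundary cases. The sets \<open>P\<close> and \<open>Q\<close> prescribe the traces of \<open>A\<close> and \<open>B\<close> on
  \<open>{1, t}\<close>; the elements of \<open>P - Q\<close> are forced into \<open>X = A - B\<close> and those of \<open>Q - P\<close> out of it, which
  accounts for the shifts in the binomial coefficient. The bound on \<open>card (P - Q)\<close> excludes the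
  case where no \<open>X\<close> exists but truncated subtraction would make the binomial coefficient nonzero.
\<close>
lemma counted_by_boundary:
  assumes "2 \<le> t" "j1 < t" "j2 < t" "t < j1 + j2" "odd l_int" "odd l_sym"
    and PQ: "P \<union> Q = {1, t}" and few: "card (P - Q) \<le> t - j2"
  shows "counted_by t j1 j2 l_int l_sym
    {(A, B) \<in> pair_family t j1 j2 l_int l_sym. {1, t} \<inter> A = P \<and> {1, t} \<inter> B = Q}
    ((l_int - 1) div 2 + of_bool (P \<inter> Q \<noteq> {})) ((l_sym - 1) div 2 + of_bool (P \<inter> Q \<noteq> {1, t}))
    ((2 * t - (j1 + j2) - card (sym_diff P Q)) choose (t - j2 - card (P - Q)))"
    (is "counted_by _ _ _ _ _ ?S ?m ?m' ?b")
proof -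
  define n where "n = j1 + j2 - t"
  define a where "a \<longleftrightarrow> 1 \<in> P \<inter> Q"
  define s where "s \<longleftrightarrow> t \<in> P \<inter> Q"
  have n: "0 < n" "n < t" "2 * t - (j1 + j2) = t - n" using assms by (auto simp: n_def)
  have sub: "P \<subseteq> {1, t}" "Q \<subseteq> {1, t}" using PQ by auto
  have as: "P \<inter> Q \<noteq> {} \<longleftrightarrow> a \<or> s" "P \<inter> Q \<noteq> {1, t} \<longleftrightarrow> \<not> a \<or> \<not> s"
    using sub by (auto simp: a_def s_def)
  have ends: "{1, t} \<inter> C = P \<inter> Q \<longleftrightarrow> (1 \<in> C \<longleftrightarrow> a) \<and> (t \<in> C \<longleftrightarrow> s)" for C
    using sub by (auto simp: a_def s_def)
  have mem: "A \<inter> B \<subseteq> {1..t}" "sym_diff A B = {1..t} - A \<inter> B"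
    "decomposition_size t (A \<inter> B) = l_int" "l_int = l_sym" "{1, t} \<inter> (A \<inter> B) = P \<inter> Q"
    if "(A, B) \<in> ?S" for A B
  proof -
    have F: "(A, B) \<in> pair_family t j1 j2 l_int l_sym" using that by auto
    then show C: "A \<inter> B \<subseteq> {1..t}" and q: "decomposition_size t (A \<inter> B) = l_int"
      by (auto simp: pair_family_def)
    show D: "sym_diff A B = {1..t} - A \<inter> B" by (rule pair_family_member[OF F])
    have "decomposition_size t (sym_diff A B) = l_sym" using F by (auto simp: pair_family_def)
    then show "l_int = l_sym"
      using q decomposition_size_complement[OF _ C] assms(1) unfolding D by simp
    show "{1, t} \<inter> (A \<inter> B) = P \<inter> Q" using that by blast
  qed
  have intervals: "num_intervals (A \<inter> B) = ?m" "num_intervals (sym_diff A B) = ?m'" if AB: "(A, B) \<in> ?S" for A B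
  proof -
    note m = mem[OF AB]
    have "finite (A \<inter> B)" using m(1) finite_subset by blast
    then have "num_intervals (A \<inter> B) = runs (A \<inter> B)"
        "num_intervals (sym_diff A B) = runs ({1..t} - A \<inter> B)"
      unfolding m(2) using m(1) by (intro num_intervals_eq_runs; auto)+
    moreover have "runs (A \<inter> B) = ?m \<and> runs ({1..t} - A \<inter> B) = ?m'"
      using decomposition_size_iff_runs[OF _ m(1) assms(5), of a s] m(3,4,5) ends[of "A \<inter> B"] assms(1)
      unfolding as by auto
    ultimately show "num_intervals (A \<inter> B) = ?m" "num_intervals (sym_diff A B) = ?m'" by auto
  qed
  have count: "card ?S = num_compositions ?m n * num_compositions ?m' (t - n) * ?b"
    if l: "l_int = l_sym"
  proof -
    let ?K = "{C. C \<subseteq> {1..t} \<and> card C = n \<and> decomposition_size t C = l_int \<and>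
      (1 \<in> C \<longleftrightarrow> a) \<and> (t \<in> C \<longleftrightarrow> s)}"
    let ?X = "\<lambda>C. {X. P - Q \<subseteq> X \<and> X \<subseteq> {1..t} - C - (Q - P) \<and> card X = t - j2}"
    have "bij_betw (\<lambda>(A, B). (A \<inter> B, A - B)) ?S (Sigma ?K ?X)"
    proof (rule bij_betwI[where g = "\<lambda>(C, X). (C \<union> X, {1..t} - X)"])
      show "(\<lambda>(A, B). (A \<inter> B, A - B)) \<in> ?S \<rightarrow> Sigma ?K ?X"
      proof (rule funcsetI)
        fix x assume "x \<in> ?S"
        then obtain A B where x: "x = (A, B)" and m: "(A, B) \<in> ?S" by (cases x) auto
        then have AB: "(A, B) \<in> pair_family t j1 j2 l_int l_sym"
          and P: "P = {1, t} \<inter> A" and Q: "Q = {1, t} \<inter> B" by auto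
        have "A \<inter> B \<in> ?K"
          using mem[OF m] pair_family_member[OF AB] ends[of "A \<inter> B"] by (simp add: n_def)
        moreover have "A - B \<in> ?X (A \<inter> B)"
          using pair_family_member[OF AB] unfolding P Q by blast
        ultimately show "(\<lambda>(A, B). (A \<inter> B, A - B)) x \<in> Sigma ?K ?X" unfolding x by simp
      qed
      show "(\<lambda>(C, X). (C \<union> X, {1..t} - X)) \<in> Sigma ?K ?X \<rightarrow> ?S"
      proof (rule funcsetI)
        fix y assume "y \<in> Sigma ?K ?X"
        then obtain C X where y: "y = (C, X)" and C: "C \<in> ?K" and X: "X \<in> ?X C" by blast
        have fin: "finite C" "finite X" using C X finite_subset by blast+
        have CI: "{1, t} \<inter> C = P \<inter> Q" using C ends[of C] by auto
        have XI: "{1, t} \<inter> X = P - Q" using X PQ CI by blast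
        have Int: "(C \<union> X) \<inter> ({1..t} - X) = C" using C X by blast
        have Un: "(C \<union> X) \<union> ({1..t} - X) = {1..t}" using C X by blast
        have D: "sym_diff (C \<union> X) ({1..t} - X) = {1..t} - C" using C X by blast
        have "card (C \<union> X) = j1"
          using C X fin assms by (subst card_Un_disjoint) (auto simp: n_def)
        moreover have "card ({1..t} - X) = j2"
          using X fin assms by (subst card_Diff_subset) auto
        moreover have "decomposition_size t ({1..t} - C) = l_sym"
          using C l assms(1) by (subst decomposition_size_complement) auto
        moreover have "C \<union> X \<subseteq> {1..t}" using C X by blast
        moreover have "card C = n" "decomposition_size t C = l_int" using C by blast+
        ultimately have "(C \<union> X, {1..t} - X) \<in> pair_family t j1 j2 l_int l_sym"
          unfolding pair_family_def mem_Collect_eq prod.case Int Un D using n(1) assms(2,3) by simp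
        moreover have "{1, t} \<inter> (C \<union> X) = P" using CI XI by blast
        moreover have "{1, t} \<inter> ({1..t} - X) = Q"
        proof -
          have "{1, t} \<subseteq> {1..t}" using assms(1) by auto
          then show ?thesis using XI PQ by blast
        qed
        ultimately show "(\<lambda>(C, X). (C \<union> X, {1..t} - X)) y \<in> ?S" unfolding y by simp
      qed
      show "(\<lambda>(C, X). (C \<union> X, {1..t} - X)) ((\<lambda>(A, B). (A \<inter> B, A - B)) x) = x" if "x \<in> ?S" for x
      proof -
        obtain A B where x: "x = (A, B)" by (cases x)
        then have "(A, B) \<in> pair_family t j1 j2 l_int l_sym" using that by auto
        from pair_family_member(1)[OF this] show ?thesis unfolding x by auto
      qed
      show "(\<lambda>(A, B). (A \<inter> B, A - B)) ((\<lambda>(C, X). (C \<union> X, {1..t} - X)) y) = y"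
        if "y \<in> Sigma ?K ?X" for y
        using that by auto
    qed
    then have "card ?S = card (Sigma ?K ?X)" by (rule bij_betw_same_card)
    also have "\<dots> = (\<Sum>C\<in>?K. card (?X C))"
    proof (rule card_SigmaI)
      show "finite ?K" by (rule finite_subset[of _ "Pow {1..t}"]) auto
      show "\<forall>C\<in>?K. finite (?X C)" by (auto intro: finite_subset[of _ "Pow {1..t}"])
    qed
    also have "\<dots> = (\<Sum>C\<in>?K. ?b)"
    proof (rule sum.cong[OF refl])
      fix C assume C: "C \<in> ?K"
      let ?G = "{1..t} - C - (Q - P)"
      have CI: "{1, t} \<inter> C = P \<inter> Q" using C ends[of C] by auto
      have fin: "finite C" "finite P" "finite Q" using C sub finite_subset by blast+
      have "{1, t} \<subseteq> {1..t}" using assms(1) by auto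
      then have QP: "Q - P \<subseteq> {1..t} - C" and PG: "P - Q \<subseteq> ?G" using CI sub by blast+
      have "card ?G = t - n - card (Q - P)"
        using QP C fin by (simp add: card_Diff_subset)
      moreover have "card (sym_diff P Q) = card (P - Q) + card (Q - P)"
        using fin by (intro card_Un_disjoint) auto
      ultimately show "card (?X C) = ?b"
        using card_subsets_between[OF _ PG few] n(3) by (simp add: add.commute add.left_commute)
    qed
    also have "\<dots> = num_compositions ?m n * num_compositions ?m' (t - n) * ?b"
      using card_subsets_by_decomposition_size[OF _ assms(5) n(1,2), of a s] assms(1) l
      unfolding as by simp
    finally show ?thesis .
  qed
  show ?thesis
    unfolding counted_by_def n(3) n_def[symmetric]
  proof (intro conjI impI)
    assume "?S \<noteq> {}"
    then obtain x where "x \<in> ?S" unfolding ex_in_conv[symmetric] by (elim exE)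
    moreover obtain A B where "x = (A, B)" by (cases x)
    ultimately have "(A, B) \<in> ?S" by (simp only:)
    then show "l_int = l_sym" by (rule mem(4))
  next
    show "\<forall>(A, B)\<in>?S. num_intervals (A \<inter> B) = ?m \<and> num_intervals (sym_diff A B) = ?m'"
    proof (rule ballI)
      fix x assume "x \<in> ?S"
      moreover obtain A B where "x = (A, B)" by (cases x)
      ultimately show "case x of (A, B) \<Rightarrow> num_intervals (A \<inter> B) = ?m \<and> num_intervals (sym_diff A B) = ?m'"
        using intervals[of A B] by (simp only: prod.case)
    qed
  next
    assume l: "l_int = l_sym"
    from count[OF l, unfolded n(3)]
    show "card ?S = num_compositions ?m n * num_compositions ?m' (t - n) *
        ((t - n - card (sym_diff P Q)) choose (t - j2 - card (P - Q)))" .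
  qed
qed

lemma pair_family_swap:
  "(B, A) \<in> pair_family t j2 j1 l_int l_sym \<longleftrightarrow> (A, B) \<in> pair_family t j1 j2 l_int l_sym"
proof -
  have eqs: "A \<inter> B = B \<inter> A" "A \<union> B = B \<union> A" "sym_diff A B = sym_diff B A" by blast+
  show ?thesis
    unfolding pair_family_def mem_Collect_eq prod.case eqs max.commute[of j1 j2]
    by (rule iffI; elim conjE; intro conjI; assumption)
qed

text \<open>
  Intersection and symmetric difference are symmetric in \<open>A\<close> and \<open>B\<close>, so exchanging the two
  turns a statement about \<open>t - j2 = card (A - B)\<close> into one about \<open>t - j1 = card (B - A)\<close>.
\<close>
lemma counted_by_swap:
  assumes "counted_by t j2 j1 l_int l_sym
    {(B, A) \<in> pair_family t j2 j1 l_int l_sym. Q B \<and> P A} m m' b"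
  shows "counted_by t j1 j2 l_int l_sym
    {(A, B) \<in> pair_family t j1 j2 l_int l_sym. P A \<and> Q B} m m' b"
proof -
  let ?S = "{(A, B) \<in> pair_family t j1 j2 l_int l_sym. P A \<and> Q B}"
  have S: "{(B, A) \<in> pair_family t j2 j1 l_int l_sym. Q B \<and> P A} = prod.swap ` ?S"
  proof (rule set_eqI)
    fix x :: "nat set \<times> nat set"
    obtain B A where x: "x = (B, A)" by (cases x)
    show "x \<in> {(B, A) \<in> pair_family t j2 j1 l_int l_sym. Q B \<and> P A} \<longleftrightarrow> x \<in> prod.swap ` ?S"
      unfolding x pair_in_swap_image mem_Collect_eq prod.case pair_family_swap[of B A]
      by (simp only: conj_ac)
  qed
  note unfolded = assms[unfolded S counted_by_def]
  have count: "l_int = l_sym \<longrightarrow> card (prod.swap ` ?S) =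
      num_compositions m (j2 + j1 - t) * num_compositions m' (2 * t - (j2 + j1)) * b"
    by (rule conjunct1[OF unfolded])
  have nonempty: "prod.swap ` ?S \<noteq> {} \<longrightarrow> l_int = l_sym"
    by (rule conjunct1[OF conjunct2[OF unfolded]])
  have intervals: "\<forall>(B, A)\<in>prod.swap ` ?S.
      num_intervals (B \<inter> A) = m \<and> num_intervals (sym_diff B A) = m'"
    by (rule conjunct2[OF conjunct2[OF unfolded]])
  have card: "card (prod.swap ` ?S) = card ?S" by (intro card_image) simp
  show ?thesis
    unfolding counted_by_def
  proof (intro conjI)
    show "l_int = l_sym \<longrightarrow> card ?S =
        num_compositions m (j1 + j2 - t) * num_compositions m' (2 * t - (j1 + j2)) * b"
      using count unfolding card add.commute[of j2 j1] .
    show "?S \<noteq> {} \<longrightarrow> l_int = l_sym" using nonempty unfolding image_is_empty .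
    show "\<forall>(A, B)\<in>?S. num_intervals (A \<inter> B) = m \<and> num_intervals (sym_diff A B) = m'"
    proof (rule ballI)
      fix x assume x: "x \<in> ?S"
      obtain A B where AB: "x = (A, B)" by (cases x)
      have "(B, A) \<in> prod.swap ` ?S" using x unfolding AB pair_in_swap_image .
      from bspec[OF intervals this]
      show "case x of (A, B) \<Rightarrow> num_intervals (A \<inter> B) = m \<and> num_intervals (sym_diff A B) = m'"
        unfolding AB prod.case by (simp only: Int_commute Un_commute)
    qed
  qed
qed

theorem theorem4p6:
  fixes t j1 j2 l_int l_sym :: nat
  defines "F \<equiv> pair_family t j1 j2 l_int l_sym"
  assumes "3 \<le> t"
    and "j1 < t" and "j2 < t" and "t < j1 + j2"
    and "odd l_int" and "l_int \<in> {1..t}"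
    and "odd l_sym" and "l_sym \<in> {1..t}"
  shows
    "(\<forall>(A, B)\<in>F.
        card (A \<inter> B) = j1 + j2 - t \<and> card (sym_diff A B) = 2 * t - (j1 + j2) \<and>
        A \<inter> B \<noteq> {} \<and> \<not> A \<subseteq> B \<and> \<not> B \<subseteq> A \<and> A \<union> B = {1..t}) \<and>
     counted_by t j1 j2 l_int l_sym
       {(A, B)\<in>F. {1, t} \<inter> A = {1} \<and> {1, t} \<inter> B = {1, t}}
       ((l_int + 1) div 2) ((l_sym + 1) div 2)
       ((2 * t - (j1 + j2) - 1) choose (t - j2)) \<and>
     counted_by t j1 j2 l_int l_sym
       {(A, B)\<in>F. {1, t} \<inter> A = {1} \<and> {1, t} \<inter> B = {t}}
       ((l_int - 1) div 2) ((l_sym + 1) div 2)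
       ((2 * t - (j1 + j2) - 2) choose (t - j2 - 1)) \<and>
     counted_by t j1 j2 l_int l_sym
       {(A, B)\<in>F. {1, t} \<inter> A = {1, t} \<and> {1, t} \<inter> B = {1, t}}
       ((l_int + 1) div 2) ((l_sym - 1) div 2)
       ((2 * t - (j1 + j2)) choose (t - j2)) \<and>
     counted_by t j1 j2 l_int l_sym
       {(A, B)\<in>F. {1, t} \<inter> A = {1, t} \<and> card ({1, t} \<inter> B) = 0}
       ((l_int - 1) div 2) ((l_sym + 1) div 2)
       ((2 * t - (j1 + j2) - 2) choose (t - j1)) \<and>
     counted_by t j1 j2 l_int l_sym
       {(A, B)\<in>F. {1, t} \<inter> A = {1, t} \<and> {1, t} \<inter> B = {t}}
       ((l_int + 1) div 2) ((l_sym + 1) div 2)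
       ((2 * t - (j1 + j2) - 1) choose (t - j1))"
proof -
  have t: "2 \<le> t" "{1, t} \<noteq> {1}" "{1, t} \<noteq> {t}" "t \<noteq> 1" using assms by auto
  obtain k where k: "l_int = 2 * k + 1" using \<open>odd l_int\<close> by (elim oddE)
  obtain k' where k': "l_sym = 2 * k' + 1" using \<open>odd l_sym\<close> by (elim oddE)
  note js = assms(3-5) and odds = assms(6,8)
  have js': "t < j2 + j1" using js by simp
  note direct = counted_by_boundary[OF t(1) js odds]
  \<comment> \<open>When \<open>A\<close> contains both ends and \<open>B\<close> does not, ends of the interval are forced into \<open>A - B\<close>, which may
    be too small for them. After the exchange nothing is forced into the set that is chosen, as
    the free choice is then that of \<open>B - A\<close>.\<close>
  note swapped = counted_by_boundary[OF t(1) js(2,1) js' odds]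
  have 0: "\<forall>(A, B)\<in>F.
      card (A \<inter> B) = j1 + j2 - t \<and> card (sym_diff A B) = 2 * t - (j1 + j2) \<and>
      A \<inter> B \<noteq> {} \<and> \<not> A \<subseteq> B \<and> \<not> B \<subseteq> A \<and> A \<union> B = {1..t}"
  proof (rule ballI, unfold case_prod_beta)
    fix x assume "x \<in> F"
    then have x: "(fst x, snd x) \<in> pair_family t j1 j2 l_int l_sym" by (simp add: F_def)
    have "card (fst x \<inter> snd x) \<noteq> 0" using pair_family_member(2)[OF x] js by simp
    then have "fst x \<inter> snd x \<noteq> {}" by (metis card.empty)
    then show "card (fst x \<inter> snd x) = j1 + j2 - t \<and>
        card (sym_diff (fst x) (snd x)) = 2 * t - (j1 + j2) \<and> fst x \<inter> snd x \<noteq> {} \<and>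
        \<not> fst x \<subseteq> snd x \<and> \<not> snd x \<subseteq> fst x \<and> fst x \<union> snd x = {1..t}"
      by (intro conjI pair_family_member[OF x])
  qed
  have 1: "counted_by t j1 j2 l_int l_sym
       {(A, B)\<in>F. {1, t} \<inter> A = {1} \<and> {1, t} \<inter> B = {1, t}}
       ((l_int + 1) div 2) ((l_sym + 1) div 2)
       ((2 * t - (j1 + j2) - 1) choose (t - j2))"
    using direct[of "{1}" "{1, t}"] t by (simp add: F_def k k' insert_Diff_if insert_commute)
  have 2: "counted_by t j1 j2 l_int l_sym
       {(A, B)\<in>F. {1, t} \<inter> A = {1} \<and> {1, t} \<inter> B = {t}}
       ((l_int - 1) div 2) ((l_sym + 1) div 2)
       ((2 * t - (j1 + j2) - 2) choose (t - j2 - 1))"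
    using direct[of "{1}" "{t}"] t js by (simp add: F_def k k' insert_Diff_if insert_commute)
  have 3: "counted_by t j1 j2 l_int l_sym
       {(A, B)\<in>F. {1, t} \<inter> A = {1, t} \<and> {1, t} \<inter> B = {1, t}}
       ((l_int + 1) div 2) ((l_sym - 1) div 2)
       ((2 * t - (j1 + j2)) choose (t - j2))"
    using direct[of "{1, t}" "{1, t}"] t by (simp add: F_def k k')
  have no_ends: "card ({1, t} \<inter> B) = 0 \<longleftrightarrow> {1, t} \<inter> B = {}" for B by simp
  have 4: "counted_by t j1 j2 l_int l_sym
       {(A, B)\<in>F. {1, t} \<inter> A = {1, t} \<and> card ({1, t} \<inter> B) = 0}
       ((l_int - 1) div 2) ((l_sym + 1) div 2)
       ((2 * t - (j1 + j2) - 2) choose (t - j1))"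
    unfolding F_def no_ends
    by (rule counted_by_swap)
      (use swapped[of "{}" "{1, t}"] t in \<open>simp add: k k' add.commute\<close>)
  have 5: "counted_by t j1 j2 l_int l_sym
       {(A, B)\<in>F. {1, t} \<inter> A = {1, t} \<and> {1, t} \<inter> B = {t}}
       ((l_int + 1) div 2) ((l_sym + 1) div 2)
       ((2 * t - (j1 + j2) - 1) choose (t - j1))"
    unfolding F_def
    by (rule counted_by_swap)
      (use swapped[of "{t}" "{1, t}"] t in \<open>simp add: k k' add.commute insert_Diff_if insert_commute\<close>)
  show ?thesis by (intro conjI) (fact 0 1 2 3 4 5)+
qed

end
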